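(* For a category $\mathcal C$ with finite limits, the following conditions are equivalent: (a) $\mathcal C$ is protomodular; (b) every binary relation in $\mathcal C$ which is left pseudoreflexive and left pseudosymmetric is symmetric; (c) every binary relation in $\mathcal C$ which is left pseudoreflexive and left pseudosymmetric is pseudoreflexive.
   Context: A binary relation $R$ on an object $X$ is a subobject of $X\times X$, given by a jointly monomorphic pair $d,c\colon R\rightrightarrows X$. The opposite relation $R^\circ$ is given by the pair $c,d\colon R\rightrightarrows X$. $R$ is symmetric if $R\le R^\circ$ as subobjects of $X\times X$. $R$ is left pseudoreflexive if there is a morphism $e\colon R\to R$ with $de=ce=d$. $R$ is right pseudoreflexive if $R^\circ$ is left pseudoreflexive. $R$ is pseudoreflexive if both $R$ and $R^\circ$ are left pseudoreflexive. A morphism $f\colon Y\to X$ exhibits $R$ as left pseudosymmetric if, on forming the pullback $Z$ of $f$ and $d\colon R\to X$, with projections $p\colon Z\to Y$ and $q\colon Z\to R$ (so $fp=dq$), there is a morphism $g\colon Z\to R$ with $dg=cq$ and $cg=fp$. $R$ is left pseudosymmetric if there exist an object $Y$ and a morphism $f\colon Y\to X$ exhibiting $R$ as left pseudosymmetric. Protomodular: a category $\mathcal C$ with pullbacks is protomodular if, for every split epimorphism $p\colon E\to B$ with section $s\colon B\to E$ ($ps=1_B$) and every morphism $f\colon A\to B$, with pullback $D=A\times_B E$ and projection $g\colon D\to E$, the pair $(g,s)$ is jointly strongly epimorphic, i.e. every monomorphism $m\colon C\to E$ through which both $g$ and $s$ factorize is invertible. *)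

theory Defs
  imports Main
begin

section \<open>Categories and finite limits\<close>

record ('o, 'm) category_data =
  Obj :: "'o set"
  Arr :: "'m set"
  Dom :: "'m \<Rightarrow> 'o"
  Cod :: "'m \<Rightarrow> 'o"
  Id :: "'o \<Rightarrow> 'm"
  Comp :: "'m \<Rightarrow> 'm \<Rightarrow> 'm" (infixr \<open>\<cdot>\<index>\<close> 70)

text \<open>
  \<open>g \<cdot>\<^bsub>C\<^esub> f\<close> is "\<open>g\<close> after \<open>f\<close>". The operations are total HOL functions, whose
  values are meaningful only on \<open>Obj\<close>, on \<open>Arr\<close> and on composable pairs of arrows.
\<close>

definition hom :: "('o, 'm) category_data \<Rightarrow> 'o \<Rightarrow> 'o \<Rightarrow> 'm set" where
  "hom C X Y = {f \<in> Arr C. Dom C f = X \<and> Cod C f = Y}"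

definition category :: "('o, 'm) category_data \<Rightarrow> bool" where
  "category C \<longleftrightarrow>
    (\<forall>f\<in>Arr C. Dom C f \<in> Obj C \<and> Cod C f \<in> Obj C) \<and>
    (\<forall>X\<in>Obj C. Id C X \<in> hom C X X) \<and>
    (\<forall>f\<in>Arr C. \<forall>g\<in>Arr C. Cod C f = Dom C g \<longrightarrow> g \<cdot>\<^bsub>C\<^esub> f \<in> hom C (Dom C f) (Cod C g)) \<and>
    (\<forall>f\<in>Arr C. f \<cdot>\<^bsub>C\<^esub> Id C (Dom C f) = f \<and> Id C (Cod C f) \<cdot>\<^bsub>C\<^esub> f = f) \<and>
    (\<forall>f\<in>Arr C. \<forall>g\<in>Arr C. \<forall>h\<in>Arr C. Cod C f = Dom C g \<and> Cod C g = Dom C h \<longrightarrow>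
      (h \<cdot>\<^bsub>C\<^esub> g) \<cdot>\<^bsub>C\<^esub> f = h \<cdot>\<^bsub>C\<^esub> (g \<cdot>\<^bsub>C\<^esub> f))"

definition is_functor ::
  "('i, 'j) category_data \<Rightarrow> ('o, 'm) category_data \<Rightarrow> ('i \<Rightarrow> 'o) \<Rightarrow> ('j \<Rightarrow> 'm) \<Rightarrow> bool" where
  "is_functor J C Fo Fa \<longleftrightarrow>
    (\<forall>i\<in>Obj J. Fo i \<in> Obj C) \<and>
    (\<forall>u\<in>Arr J. Fa u \<in> hom C (Fo (Dom J u)) (Fo (Cod J u))) \<and>
    (\<forall>i\<in>Obj J. Fa (Id J i) = Id C (Fo i)) \<and>
    (\<forall>u\<in>Arr J. \<forall>v\<in>Arr J. Cod J u = Dom J v \<longrightarrow> Fa (v \<cdot>\<^bsub>J\<^esub> u) = Fa v \<cdot>\<^bsub>C\<^esub> Fa u)"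

definition is_cone ::
  "('i, 'j) category_data \<Rightarrow> ('o, 'm) category_data \<Rightarrow> ('i \<Rightarrow> 'o) \<Rightarrow> ('j \<Rightarrow> 'm)
    \<Rightarrow> 'o \<Rightarrow> ('i \<Rightarrow> 'm) \<Rightarrow> bool" where
  "is_cone J C Fo Fa L \<pi> \<longleftrightarrow>
    L \<in> Obj C \<and>
    (\<forall>i\<in>Obj J. \<pi> i \<in> hom C L (Fo i)) \<and>
    (\<forall>u\<in>Arr J. Fa u \<cdot>\<^bsub>C\<^esub> \<pi> (Dom J u) = \<pi> (Cod J u))"

definition is_limit ::
  "('i, 'j) category_data \<Rightarrow> ('o, 'm) category_data \<Rightarrow> ('i \<Rightarrow> 'o) \<Rightarrow> ('j \<Rightarrow> 'm)
    \<Rightarrow> 'o \<Rightarrow> ('i \<Rightarrow> 'm) \<Rightarrow> bool" where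
  "is_limit J C Fo Fa L \<pi> \<longleftrightarrow>
    is_cone J C Fo Fa L \<pi> \<and>
    (\<forall>M \<mu>. is_cone J C Fo Fa M \<mu> \<longrightarrow>
      (\<exists>!h. h \<in> hom C M L \<and> (\<forall>i\<in>Obj J. \<pi> i \<cdot>\<^bsub>C\<^esub> h = \<mu> i)))"

text \<open>
  Every finite category is isomorphic to one whose objects and arrows are natural numbers,
  so restricting index categories to these is no loss of generality. The empty index
  category (terminal objects) is included.
\<close>

definition has_finite_limits :: "('o, 'm) category_data \<Rightarrow> bool" where
  "has_finite_limits C \<longleftrightarrow>
    (\<forall>(J :: (nat, nat) category_data) Fo Fa.
      category J \<and> finite (Obj J) \<and> finite (Arr J) \<and> is_functor J C Fo Fa \<longrightarrow>
      (\<exists>L \<pi>. is_limit J C Fo Fa L \<pi>))"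

section \<open>Monomorphisms, isomorphisms and pullbacks\<close>

definition is_mono :: "('o, 'm) category_data \<Rightarrow> 'm \<Rightarrow> bool" where
  "is_mono C m \<longleftrightarrow>
    m \<in> Arr C \<and>
    (\<forall>T. \<forall>u \<in> hom C T (Dom C m). \<forall>v \<in> hom C T (Dom C m).
      m \<cdot>\<^bsub>C\<^esub> u = m \<cdot>\<^bsub>C\<^esub> v \<longrightarrow> u = v)"

definition is_invertible :: "('o, 'm) category_data \<Rightarrow> 'm \<Rightarrow> bool" where
  "is_invertible C m \<longleftrightarrow>
    m \<in> Arr C \<and>
    (\<exists>n \<in> hom C (Cod C m) (Dom C m).
      n \<cdot>\<^bsub>C\<^esub> m = Id C (Dom C m) \<and> m \<cdot>\<^bsub>C\<^esub> n = Id C (Cod C m))"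

text \<open>
  \<open>is_pullback C f d p q\<close>: the span \<open>(p, q)\<close> is a pullback of the cospan \<open>(f, d)\<close>,
  with \<open>f \<cdot> p = d \<cdot> q\<close>.
\<close>

definition is_pullback :: "('o, 'm) category_data \<Rightarrow> 'm \<Rightarrow> 'm \<Rightarrow> 'm \<Rightarrow> 'm \<Rightarrow> bool" where
  "is_pullback C f d p q \<longleftrightarrow>
    f \<in> Arr C \<and> d \<in> Arr C \<and> Cod C f = Cod C d \<and>
    p \<in> Arr C \<and> q \<in> Arr C \<and> Dom C p = Dom C q \<and>
    Cod C p = Dom C f \<and> Cod C q = Dom C d \<and>
    f \<cdot>\<^bsub>C\<^esub> p = d \<cdot>\<^bsub>C\<^esub> q \<and>
    (\<forall>T. \<forall>u \<in> hom C T (Dom C f). \<forall>v \<in> hom C T (Dom C d).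
      f \<cdot>\<^bsub>C\<^esub> u = d \<cdot>\<^bsub>C\<^esub> v \<longrightarrow>
      (\<exists>!h. h \<in> hom C T (Dom C p) \<and> p \<cdot>\<^bsub>C\<^esub> h = u \<and> q \<cdot>\<^bsub>C\<^esub> h = v))"

definition has_pullbacks :: "('o, 'm) category_data \<Rightarrow> bool" where
  "has_pullbacks C \<longleftrightarrow>
    (\<forall>f\<in>Arr C. \<forall>d\<in>Arr C. Cod C f = Cod C d \<longrightarrow> (\<exists>p q. is_pullback C f d p q))"

section \<open>Protomodular categories\<close>

definition factors_through :: "('o, 'm) category_data \<Rightarrow> 'm \<Rightarrow> 'm \<Rightarrow> bool" where
  "factors_through C g m \<longleftrightarrow> (\<exists>h \<in> hom C (Dom C g) (Dom C m). g = m \<cdot>\<^bsub>C\<^esub> h)"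

definition jointly_strongly_epic :: "('o, 'm) category_data \<Rightarrow> 'm \<Rightarrow> 'm \<Rightarrow> bool" where
  "jointly_strongly_epic C g s \<longleftrightarrow>
    g \<in> Arr C \<and> s \<in> Arr C \<and> Cod C g = Cod C s \<and>
    (\<forall>m. is_mono C m \<and> Cod C m = Cod C g \<and> factors_through C g m \<and> factors_through C s m \<longrightarrow>
      is_invertible C m)"

definition protomodular :: "('o, 'm) category_data \<Rightarrow> bool" where
  "protomodular C \<longleftrightarrow>
    has_pullbacks C \<and>
    (\<forall>A\<in>Obj C. \<forall>B\<in>Obj C. \<forall>E\<in>Obj C.
      \<forall>p \<in> hom C E B. \<forall>s \<in> hom C B E. \<forall>f \<in> hom C A B. \<forall>a g.
        p \<cdot>\<^bsub>C\<^esub> s = Id C B \<and> is_pullback C f p a g \<longrightarrow> jointly_strongly_epic C g s)"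

section \<open>Binary relations\<close>

text \<open>
  A binary relation on \<open>X\<close> is represented by a jointly monomorphic pair \<open>d, c\<close> of arrows
  from a common domain \<open>R\<close> to \<open>X\<close>; its opposite is obtained by exchanging \<open>d\<close> and \<open>c\<close>.
  Different pairs may represent the same subobject of \<open>X \<times> X\<close>; all properties defined below
  are invariant under the choice of representative.
\<close>

definition binary_relation ::
  "('o, 'm) category_data \<Rightarrow> 'o \<Rightarrow> 'm \<Rightarrow> 'm \<Rightarrow> bool" where
  "binary_relation C X d c \<longleftrightarrow>
    (\<exists>R\<in>Obj C. d \<in> hom C R X \<and> c \<in> hom C R X \<and>
      (\<forall>T. \<forall>u \<in> hom C T R. \<forall>v \<in> hom C T R.
        d \<cdot>\<^bsub>C\<^esub> u = d \<cdot>\<^bsub>C\<^esub> v \<and> c \<cdot>\<^bsub>C\<^esub> u = c \<cdot>\<^bsub>C\<^esub> v \<longrightarrow> u = v))"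

text \<open>
  The order of subobjects of \<open>X \<times> X\<close>: an arrow \<open>h\<close> satisfies
  \<open>\<langle>d', c'\<rangle> \<cdot> h = \<langle>d, c\<rangle>\<close> iff \<open>d' \<cdot> h = d\<close> and \<open>c' \<cdot> h = c\<close>.
\<close>

definition relation_le ::
  "('o, 'm) category_data \<Rightarrow> 'm \<Rightarrow> 'm \<Rightarrow> 'm \<Rightarrow> 'm \<Rightarrow> bool" where
  "relation_le C d c d' c' \<longleftrightarrow>
    (\<exists>h \<in> hom C (Dom C d) (Dom C d'). d' \<cdot>\<^bsub>C\<^esub> h = d \<and> c' \<cdot>\<^bsub>C\<^esub> h = c)"

definition symmetric_relation :: "('o, 'm) category_data \<Rightarrow> 'm \<Rightarrow> 'm \<Rightarrow> bool" where
  "symmetric_relation C d c \<longleftrightarrow> relation_le C d c c d"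

definition left_pseudoreflexive :: "('o, 'm) category_data \<Rightarrow> 'm \<Rightarrow> 'm \<Rightarrow> bool" where
  "left_pseudoreflexive C d c \<longleftrightarrow>
    (\<exists>e \<in> hom C (Dom C d) (Dom C d). d \<cdot>\<^bsub>C\<^esub> e = d \<and> c \<cdot>\<^bsub>C\<^esub> e = d)"

definition right_pseudoreflexive :: "('o, 'm) category_data \<Rightarrow> 'm \<Rightarrow> 'm \<Rightarrow> bool" where
  "right_pseudoreflexive C d c \<longleftrightarrow> left_pseudoreflexive C c d"

definition pseudoreflexive :: "('o, 'm) category_data \<Rightarrow> 'm \<Rightarrow> 'm \<Rightarrow> bool" where
  "pseudoreflexive C d c \<longleftrightarrow> left_pseudoreflexive C d c \<and> right_pseudoreflexive C d c"

text \<open>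
  Pullbacks are unique up to isomorphism, so it does not matter which pullback of \<open>f\<close>
  and \<open>d\<close> is used.
\<close>

definition exhibits_left_pseudosymmetric ::
  "('o, 'm) category_data \<Rightarrow> 'm \<Rightarrow> 'm \<Rightarrow> 'm \<Rightarrow> bool" where
  "exhibits_left_pseudosymmetric C f d c \<longleftrightarrow>
    (\<exists>p q. is_pullback C f d p q \<and>
      (\<exists>g \<in> hom C (Dom C p) (Dom C d).
        d \<cdot>\<^bsub>C\<^esub> g = c \<cdot>\<^bsub>C\<^esub> q \<and> c \<cdot>\<^bsub>C\<^esub> g = f \<cdot>\<^bsub>C\<^esub> p))"

definition left_pseudosymmetric :: "('o, 'm) category_data \<Rightarrow> 'm \<Rightarrow> 'm \<Rightarrow> bool" where
  "left_pseudosymmetric C d c \<longleftrightarrow>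
    (\<exists>Y\<in>Obj C. \<exists>f \<in> hom C Y (Cod C d). exhibits_left_pseudosymmetric C f d c)"

end

theory Submission
  imports Defs
begin

text \<open>
  The proof reads arrows into an object as its generalized elements.

  Symmetry from protomodularity. Let \<open>R\<close> be left pseudoreflexive, witnessed by \<open>e\<close>, and left
  pseudosymmetric, witnessed by \<open>f : Y \<rightarrow> X\<close> and \<open>g : Z \<rightarrow> R\<close>. The kernel pair
  \<open>E = {(r, r'). d r = d r'}\<close> of \<open>d\<close> is split over \<open>R\<close> by its first projection and the section
  \<open>r \<mapsto> (r, e r)\<close>. Let \<open>M\<close> consist of those \<open>(r, r') \<in> E\<close> for which the reverse of \<open>r'\<close> is again
  in \<open>R\<close>. The section lands in \<open>M\<close> because \<open>e r\<close> is a diagonal pair. If \<open>r\<close> comes from \<open>Z\<close>, then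
  \<open>d r' = d r\<close> lies in the image of \<open>f\<close>, so \<open>g\<close> reverses \<open>r'\<close>; hence the pullback of \<open>E\<close> along
  \<open>Z \<rightarrow> R\<close> also lands in \<open>M\<close>. Protomodularity forces \<open>M = E\<close>, and evaluation at \<open>(r, r)\<close> gives
  the reverse of an arbitrary \<open>r\<close>.

  Protomodularity from pseudoreflexivity. Let \<open>p : E \<rightarrow> B\<close> be split by \<open>s\<close>, and let the subobject
  \<open>M\<close> of \<open>E\<close> contain \<open>s\<close> and the fibres of \<open>p\<close> over the image of \<open>f : A \<rightarrow> B\<close>. Relate \<open>x\<close> to \<open>y\<close>
  in \<open>E\<close> when \<open>x \<in> M\<close> and \<open>p x = p y\<close>. Left pseudoreflexivity is clear, and \<open>s f\<close> exhibits left
  pseudosymmetry: whatever is related to \<open>s (f a)\<close> lies in a fibre that \<open>M\<close> contains. Every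
  \<open>y \<in> E\<close> is the second component of a related pair, namely \<open>(s (p y), y)\<close>, so pseudoreflexivity
  relates \<open>y\<close> to itself, that is, \<open>y \<in> M\<close>.

  The two conditions on relations are linked by reversing a pair and then applying \<open>e\<close>.
\<close>

section \<open>Elementary facts about categories\<close>

lemma hom_comp:
  assumes "category C" "f \<in> hom C X Y" "g \<in> hom C Y Z"
  shows "g \<cdot>\<^bsub>C\<^esub> f \<in> hom C X Z"
  using assms unfolding category_def hom_def by auto

lemma hom_Obj:
  assumes "category C" "f \<in> hom C X Y"
  shows "X \<in> Obj C" "Y \<in> Obj C"
  using assms unfolding category_def hom_def by auto

lemma hom_Id:
  assumes "category C" "X \<in> Obj C"
  shows "Id C X \<in> hom C X X"
  using assms unfolding category_def by auto

lemma comp_Id: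
  assumes "category C" "f \<in> hom C X Y"
  shows "f \<cdot>\<^bsub>C\<^esub> Id C X = f" "Id C Y \<cdot>\<^bsub>C\<^esub> f = f"
  using assms unfolding category_def hom_def by auto

lemma comp_assoc:
  assumes "category C" "f \<in> hom C W X" "g \<in> hom C X Y" "h \<in> hom C Y Z"
  shows "(h \<cdot>\<^bsub>C\<^esub> g) \<cdot>\<^bsub>C\<^esub> f = h \<cdot>\<^bsub>C\<^esub> (g \<cdot>\<^bsub>C\<^esub> f)"
  using assms unfolding category_def hom_def by auto

lemma hom_Dom_Cod:
  assumes "f \<in> hom C X Y"
  shows "f \<in> Arr C" "Dom C f = X" "Cod C f = Y"
  using assms unfolding hom_def by auto

lemma mono_with_section_invertible:
  assumes C: "category C" and m: "is_mono C m" "m \<in> hom C M E"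
    and n: "n \<in> hom C E M" "m \<cdot>\<^bsub>C\<^esub> n = Id C E"
  shows "is_invertible C m"
proof -
  have M: "M \<in> Obj C" using hom_Obj[OF C m(2)] by blast
  have nm: "n \<cdot>\<^bsub>C\<^esub> m \<in> hom C M M" using hom_comp[OF C m(2) n(1)] .
  have "m \<cdot>\<^bsub>C\<^esub> (n \<cdot>\<^bsub>C\<^esub> m) = m \<cdot>\<^bsub>C\<^esub> Id C M"
    using comp_assoc[OF C m(2) n(1) m(2)] n(2) comp_Id[OF C m(2)] by simp
  then have "n \<cdot>\<^bsub>C\<^esub> m = Id C M"
    using m(1) nm hom_Id[OF C M] hom_Dom_Cod[OF m(2)] unfolding is_mono_def by blast
  then show ?thesis
    using n hom_Dom_Cod[OF m(2)] unfolding is_invertible_def by auto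
qed

section \<open>The finite limits that are used\<close>

text \<open>
  One shape of diagram covers all limits needed: two spans \<open>X \<leftarrow> R \<rightarrow> X'\<close> and \<open>X \<leftarrow> R' \<rightarrow> X'\<close> with
  the same feet. Its limit consists of the pairs of elements of \<open>R\<close> and \<open>R'\<close> that lie over the same
  point of \<open>X\<close> and over the same point of \<open>X'\<close>; if each span consists of two equal arrows, it
  is a pullback. In the index category the arrows \<open>0\<close> to \<open>3\<close> are the identities, \<open>4, 5\<close> are the
  legs out of \<open>0\<close>, and \<open>6, 7\<close> those out of \<open>1\<close>. As no two non-identities are composable, a
  composite is whichever factor is not an identity.
\<close>

definition two_spans_shape :: "(nat, nat) category_data" where
  "two_spans_shape =
    \<lparr>Obj = {0, 1, 2, 3}, Arr = {0, 1, 2, 3, 4, 5, 6, 7},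
     Dom = (\<lambda>u. if u < 4 then u else if u < 6 then 0 else 1),
     Cod = (\<lambda>u. if u < 4 then u else if even u then 2 else 3),
     Id = (\<lambda>i. i),
     Comp = (\<lambda>v u. if v < 4 then u else v)\<rparr>"

lemma category_two_spans_shape: "category two_spans_shape"
  unfolding category_def two_spans_shape_def hom_def by auto

lemma limit_of_two_spans:
  assumes C: "category C" and lim: "has_finite_limits C"
    and d: "d \<in> hom C R X" and c: "c \<in> hom C R X'"
    and d': "d' \<in> hom C R' X" and c': "c' \<in> hom C R' X'"
  obtains L p q where "p \<in> hom C L R" "q \<in> hom C L R'"
    "d \<cdot>\<^bsub>C\<^esub> p = d' \<cdot>\<^bsub>C\<^esub> q" "c \<cdot>\<^bsub>C\<^esub> p = c' \<cdot>\<^bsub>C\<^esub> q"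
    "\<And>T u v. \<lbrakk>u \<in> hom C T R; v \<in> hom C T R';
       d \<cdot>\<^bsub>C\<^esub> u = d' \<cdot>\<^bsub>C\<^esub> v; c \<cdot>\<^bsub>C\<^esub> u = c' \<cdot>\<^bsub>C\<^esub> v\<rbrakk>
      \<Longrightarrow> \<exists>!h. h \<in> hom C T L \<and> p \<cdot>\<^bsub>C\<^esub> h = u \<and> q \<cdot>\<^bsub>C\<^esub> h = v"
proof -
  let ?J = "two_spans_shape"
  define Fo where "Fo = (\<lambda>i::nat. if i = 0 then R else if i = 1 then R' else if i = 2 then X else X')"
  define Fa where "Fa = (\<lambda>u::nat. if u < 4 then Id C (Fo u) else [d, c, d', c'] ! (u - 4))"
  note obs = hom_Obj[OF C d] hom_Obj[OF C c] hom_Obj[OF C d']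
  have "is_functor ?J C Fo Fa"
    using obs d c d' c' hom_Id[OF C]
    by (auto simp: is_functor_def two_spans_shape_def Fo_def Fa_def comp_Id[OF C hom_Id[OF C]]
        comp_Id[OF C d] comp_Id[OF C c] comp_Id[OF C d'] comp_Id[OF C c'])
  moreover have "finite (Obj ?J)" "finite (Arr ?J)" by (simp_all add: two_spans_shape_def)
  ultimately obtain L \<pi> where L: "is_limit ?J C Fo Fa L \<pi>"
    using lim category_two_spans_shape unfolding has_finite_limits_def by blast
  have cone: "is_cone ?J C Fo Fa L \<pi>" using L unfolding is_limit_def by blast
  have legs: "\<pi> 0 \<in> hom C L R" "\<pi> 1 \<in> hom C L R'"
    using cone by (auto simp: is_cone_def two_spans_shape_def Fo_def)
  have eqs: "d \<cdot>\<^bsub>C\<^esub> \<pi> 0 = \<pi> 2" "c \<cdot>\<^bsub>C\<^esub> \<pi> 0 = \<pi> 3" "d' \<cdot>\<^bsub>C\<^esub> \<pi> 1 = \<pi> 2" "c' \<cdot>\<^bsub>C\<^esub> \<pi> 1 = \<pi> 3"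
    using cone by (auto simp: is_cone_def two_spans_shape_def Fo_def Fa_def)
  have univ: "\<exists>!h. h \<in> hom C T L \<and> \<pi> 0 \<cdot>\<^bsub>C\<^esub> h = u \<and> \<pi> 1 \<cdot>\<^bsub>C\<^esub> h = v"
    if u: "u \<in> hom C T R" and v: "v \<in> hom C T R'"
      and du: "d \<cdot>\<^bsub>C\<^esub> u = d' \<cdot>\<^bsub>C\<^esub> v" and cu: "c \<cdot>\<^bsub>C\<^esub> u = c' \<cdot>\<^bsub>C\<^esub> v" for T u v
  proof -
    define \<mu> where "\<mu> = (\<lambda>i::nat. [u, v, d \<cdot>\<^bsub>C\<^esub> u, c \<cdot>\<^bsub>C\<^esub> u] ! i)"
    have "is_cone ?J C Fo Fa T \<mu>"
      using hom_Obj[OF C u] u v hom_comp[OF C u d] hom_comp[OF C u c] du[symmetric] cu[symmetric]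
      by (auto simp: is_cone_def two_spans_shape_def Fo_def Fa_def \<mu>_def comp_Id[OF C u]
          comp_Id[OF C v] comp_Id[OF C hom_comp[OF C u d]] comp_Id[OF C hom_comp[OF C u c]])
    then have "\<exists>!h. h \<in> hom C T L \<and> (\<forall>i\<in>Obj ?J. \<pi> i \<cdot>\<^bsub>C\<^esub> h = \<mu> i)"
      using L unfolding is_limit_def by blast
    moreover have "(\<forall>i\<in>Obj ?J. \<pi> i \<cdot>\<^bsub>C\<^esub> h = \<mu> i) \<longleftrightarrow> \<pi> 0 \<cdot>\<^bsub>C\<^esub> h = u \<and> \<pi> 1 \<cdot>\<^bsub>C\<^esub> h = v"
      if h: "h \<in> hom C T L" for h
      using comp_assoc[OF C h legs(1) d] comp_assoc[OF C h legs(1) c] eqs(1,2)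
      by (auto simp: two_spans_shape_def \<mu>_def)
    ultimately show ?thesis by (metis (no_types, lifting))
  qed
  show ?thesis
    by (rule that[OF legs]) (use eqs univ in auto)
qed

lemma pullback_exists:
  assumes C: "category C" and lim: "has_finite_limits C"
    and f: "f \<in> hom C Y X" and d: "d \<in> hom C R X"
  obtains Z p q where "is_pullback C f d p q" "p \<in> hom C Z Y" "q \<in> hom C Z R"
proof -
  obtain Z p q where p: "p \<in> hom C Z Y" and q: "q \<in> hom C Z R"
    and sq: "f \<cdot>\<^bsub>C\<^esub> p = d \<cdot>\<^bsub>C\<^esub> q" "f \<cdot>\<^bsub>C\<^esub> p = d \<cdot>\<^bsub>C\<^esub> q"
    and univ: "\<And>T u v. \<lbrakk>u \<in> hom C T Y; v \<in> hom C T R;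
       f \<cdot>\<^bsub>C\<^esub> u = d \<cdot>\<^bsub>C\<^esub> v; f \<cdot>\<^bsub>C\<^esub> u = d \<cdot>\<^bsub>C\<^esub> v\<rbrakk>
      \<Longrightarrow> \<exists>!h. h \<in> hom C T Z \<and> p \<cdot>\<^bsub>C\<^esub> h = u \<and> q \<cdot>\<^bsub>C\<^esub> h = v"
    by (rule limit_of_two_spans[OF C lim f f d d]) (rule that)
  have "is_pullback C f d p q"
    unfolding is_pullback_def hom_Dom_Cod[OF f] hom_Dom_Cod[OF d] hom_Dom_Cod[OF p] hom_Dom_Cod[OF q]
    using sq univ hom_Dom_Cod(1)[OF f] hom_Dom_Cod(1)[OF d] hom_Dom_Cod(1)[OF p] hom_Dom_Cod(1)[OF q]
    by blast
  then show ?thesis using that p q by blast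
qed

lemma pullback_square:
  assumes "is_pullback C f d p q" "f \<in> hom C Y X" "d \<in> hom C R X"
  obtains Z where "p \<in> hom C Z Y" "q \<in> hom C Z R" "f \<cdot>\<^bsub>C\<^esub> p = d \<cdot>\<^bsub>C\<^esub> q"
  using assms unfolding is_pullback_def hom_def by auto

lemma pullback_lift:
  assumes "is_pullback C f d p q" "f \<in> hom C Y X" "d \<in> hom C R X" "p \<in> hom C Z Y"
    and "u \<in> hom C T Y" "v \<in> hom C T R" "f \<cdot>\<^bsub>C\<^esub> u = d \<cdot>\<^bsub>C\<^esub> v"
  obtains h where "h \<in> hom C T Z" "p \<cdot>\<^bsub>C\<^esub> h = u" "q \<cdot>\<^bsub>C\<^esub> h = v"
  using assms(1,5-7) unfolding is_pullback_def
    hom_Dom_Cod[OF assms(2)] hom_Dom_Cod[OF assms(3)] hom_Dom_Cod[OF assms(4)]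
  by blast

lemma pullback_joint_mono:
  assumes C: "category C" and pb: "is_pullback C f d p q"
    and f: "f \<in> hom C Y X" and d: "d \<in> hom C R X" and p: "p \<in> hom C Z Y" and q: "q \<in> hom C Z R"
    and h: "h \<in> hom C T Z" and k: "k \<in> hom C T Z"
    and eq: "p \<cdot>\<^bsub>C\<^esub> h = p \<cdot>\<^bsub>C\<^esub> k" "q \<cdot>\<^bsub>C\<^esub> h = q \<cdot>\<^bsub>C\<^esub> k"
  shows "h = k"
proof -
  have sq: "f \<cdot>\<^bsub>C\<^esub> p = d \<cdot>\<^bsub>C\<^esub> q" using pb unfolding is_pullback_def by blast
  have "f \<cdot>\<^bsub>C\<^esub> (p \<cdot>\<^bsub>C\<^esub> k) = d \<cdot>\<^bsub>C\<^esub> (q \<cdot>\<^bsub>C\<^esub> k)"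
    using comp_assoc[OF C k p f] comp_assoc[OF C k q d] sq by simp
  then have "\<exists>!l. l \<in> hom C T Z \<and> p \<cdot>\<^bsub>C\<^esub> l = p \<cdot>\<^bsub>C\<^esub> k \<and> q \<cdot>\<^bsub>C\<^esub> l = q \<cdot>\<^bsub>C\<^esub> k"
    using pb hom_comp[OF C k p] hom_comp[OF C k q]
      hom_Dom_Cod[OF f] hom_Dom_Cod[OF d] hom_Dom_Cod[OF p]
    unfolding is_pullback_def by metis
  then show ?thesis using h k eq by blast
qed

section \<open>Protomodularity implies symmetry\<close>

text \<open>
  This is the pullback of \<open>(d, c)\<close> along \<open>(x, y) : E \<rightarrow> X \<times> X\<close>, expressed without the product. The
  projection \<open>m\<close> is monic because the component \<open>w\<close> in \<open>R\<close> is determined by its two images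
  in \<open>X\<close>. The last property lets membership in this subobject be tested on generalized elements.
\<close>

lemma inverse_image_of_relation:
  assumes C: "category C" and lim: "has_finite_limits C"
    and d: "d \<in> hom C R X" and c: "c \<in> hom C R X"
    and rel: "binary_relation C X d c"
    and x: "x \<in> hom C E X" and y: "y \<in> hom C E X"
  obtains M m w where "m \<in> hom C M E" "is_mono C m" "w \<in> hom C M R"
    "d \<cdot>\<^bsub>C\<^esub> w = x \<cdot>\<^bsub>C\<^esub> m" "c \<cdot>\<^bsub>C\<^esub> w = y \<cdot>\<^bsub>C\<^esub> m"
    "\<And>T u v. \<lbrakk>u \<in> hom C T E; v \<in> hom C T R;
       d \<cdot>\<^bsub>C\<^esub> v = x \<cdot>\<^bsub>C\<^esub> u; c \<cdot>\<^bsub>C\<^esub> v = y \<cdot>\<^bsub>C\<^esub> u\<rbrakk> \<Longrightarrow> factors_through C u m"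
proof -
  obtain M m w where m: "m \<in> hom C M E" and w: "w \<in> hom C M R"
    and xm: "x \<cdot>\<^bsub>C\<^esub> m = d \<cdot>\<^bsub>C\<^esub> w" and ym: "y \<cdot>\<^bsub>C\<^esub> m = c \<cdot>\<^bsub>C\<^esub> w"
    and univ: "\<And>T u v. \<lbrakk>u \<in> hom C T E; v \<in> hom C T R;
       x \<cdot>\<^bsub>C\<^esub> u = d \<cdot>\<^bsub>C\<^esub> v; y \<cdot>\<^bsub>C\<^esub> u = c \<cdot>\<^bsub>C\<^esub> v\<rbrakk>
      \<Longrightarrow> \<exists>!h. h \<in> hom C T M \<and> m \<cdot>\<^bsub>C\<^esub> h = u \<and> w \<cdot>\<^bsub>C\<^esub> h = v"
    by (rule limit_of_two_spans[OF C lim x y d c]) (rule that)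
  have mono: "is_mono C m"
  proof -
    have "u = v" if u: "u \<in> hom C T M" and v: "v \<in> hom C T M"
      and eq: "m \<cdot>\<^bsub>C\<^esub> u = m \<cdot>\<^bsub>C\<^esub> v" for T u v
    proof -
      have dw: "d \<cdot>\<^bsub>C\<^esub> (w \<cdot>\<^bsub>C\<^esub> u) = x \<cdot>\<^bsub>C\<^esub> (m \<cdot>\<^bsub>C\<^esub> u)"
        "d \<cdot>\<^bsub>C\<^esub> (w \<cdot>\<^bsub>C\<^esub> v) = x \<cdot>\<^bsub>C\<^esub> (m \<cdot>\<^bsub>C\<^esub> v)"
        using comp_assoc[OF C u w d] comp_assoc[OF C u m x]
          comp_assoc[OF C v w d] comp_assoc[OF C v m x] xm by auto
      have cw: "c \<cdot>\<^bsub>C\<^esub> (w \<cdot>\<^bsub>C\<^esub> u) = y \<cdot>\<^bsub>C\<^esub> (m \<cdot>\<^bsub>C\<^esub> u)"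
        "c \<cdot>\<^bsub>C\<^esub> (w \<cdot>\<^bsub>C\<^esub> v) = y \<cdot>\<^bsub>C\<^esub> (m \<cdot>\<^bsub>C\<^esub> v)"
        using comp_assoc[OF C u w c] comp_assoc[OF C u m y]
          comp_assoc[OF C v w c] comp_assoc[OF C v m y] ym by auto
      have "w \<cdot>\<^bsub>C\<^esub> u = w \<cdot>\<^bsub>C\<^esub> v"
        using rel dw cw eq hom_comp[OF C u w] hom_comp[OF C v w] hom_Dom_Cod(2)[OF d]
        unfolding binary_relation_def by (metis hom_Dom_Cod(2))
      then show ?thesis
        using univ[OF hom_comp[OF C u m] hom_comp[OF C u w]] dw cw u v eq by metis
    qed
    then show ?thesis using hom_Dom_Cod[OF m] unfolding is_mono_def by blast
  qed
  have "factors_through C u m"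
    if uv: "u \<in> hom C T E" "v \<in> hom C T R" "d \<cdot>\<^bsub>C\<^esub> v = x \<cdot>\<^bsub>C\<^esub> u" "c \<cdot>\<^bsub>C\<^esub> v = y \<cdot>\<^bsub>C\<^esub> u"
    for T u v
  proof -
    obtain h where "h \<in> hom C T M" "m \<cdot>\<^bsub>C\<^esub> h = u"
      using univ[OF uv(1,2)] uv(3,4) by auto
    then show ?thesis
      using hom_Dom_Cod[OF uv(1)] hom_Dom_Cod[OF m] unfolding factors_through_def by auto
  qed
  then show ?thesis using that m mono w xm ym by metis
qed

lemma binary_relation_hom:
  assumes "binary_relation C X d c"
  obtains R where "d \<in> hom C R X" "c \<in> hom C R X"
  using assms unfolding binary_relation_def by blast

lemma binary_relation_opposite:
  "binary_relation C X d c \<Longrightarrow> binary_relation C X c d"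
  unfolding binary_relation_def by blast

lemma protomodular_imp_symmetric:
  assumes C: "category C" and lim: "has_finite_limits C" and pm: "protomodular C"
    and rel: "binary_relation C X d c"
    and lpr: "left_pseudoreflexive C d c" and lps: "left_pseudosymmetric C d c"
  shows "symmetric_relation C d c"
proof -
  obtain R where d: "d \<in> hom C R X" and c: "c \<in> hom C R X"
    by (rule binary_relation_hom[OF rel]) (rule that)
  have R: "R \<in> Obj C" using hom_Obj[OF C d] by blast
  obtain e where e: "e \<in> hom C R R" and de: "d \<cdot>\<^bsub>C\<^esub> e = d" and ce: "c \<cdot>\<^bsub>C\<^esub> e = d"
    using lpr hom_Dom_Cod[OF d] unfolding left_pseudoreflexive_def by auto
  obtain Y f p q g where f: "f \<in> hom C Y X" and pbZ: "is_pullback C f d p q"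
    and g0: "g \<in> hom C (Dom C p) R" and dg: "d \<cdot>\<^bsub>C\<^esub> g = c \<cdot>\<^bsub>C\<^esub> q" and cg: "c \<cdot>\<^bsub>C\<^esub> g = f \<cdot>\<^bsub>C\<^esub> p"
    using lps hom_Dom_Cod[OF d]
    unfolding left_pseudosymmetric_def exhibits_left_pseudosymmetric_def by auto
  obtain Z where p: "p \<in> hom C Z Y" and q: "q \<in> hom C Z R" and fp: "f \<cdot>\<^bsub>C\<^esub> p = d \<cdot>\<^bsub>C\<^esub> q"
    by (rule pullback_square[OF pbZ f d]) (rule that)
  have g: "g \<in> hom C Z R" using g0 hom_Dom_Cod[OF p] by simp

  \<comment> \<open>The kernel pair of \<open>d\<close>, its section \<open>r \<mapsto> (r, e r)\<close> and its diagonal.\<close>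
  obtain E \<pi> \<rho> where pbE: "is_pullback C d d \<pi> \<rho>" and \<pi>: "\<pi> \<in> hom C E R" and \<rho>: "\<rho> \<in> hom C E R"
    by (rule pullback_exists[OF C lim d d]) (rule that)
  have sqE: "d \<cdot>\<^bsub>C\<^esub> \<pi> = d \<cdot>\<^bsub>C\<^esub> \<rho>" using pbE unfolding is_pullback_def by blast
  have E: "E \<in> Obj C" using hom_Obj[OF C \<pi>] by blast
  have idR: "Id C R \<in> hom C R R" using hom_Id[OF C R] .
  obtain s where s: "s \<in> hom C R E" and \<pi>s: "\<pi> \<cdot>\<^bsub>C\<^esub> s = Id C R" and \<rho>s: "\<rho> \<cdot>\<^bsub>C\<^esub> s = e"
    using pullback_lift[OF pbE d d \<pi> idR e] de comp_Id[OF C d] by metis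
  obtain \<delta> where \<delta>: "\<delta> \<in> hom C R E" and \<rho>\<delta>: "\<rho> \<cdot>\<^bsub>C\<^esub> \<delta> = Id C R"
    using pullback_lift[OF pbE d d \<pi> idR idR] by metis

  \<comment> \<open>The subobject of those \<open>(r, r')\<close> for which the reverse of \<open>r'\<close> is in \<open>R\<close>.\<close>
  obtain M m w where m: "m \<in> hom C M E" and mono: "is_mono C m" and w: "w \<in> hom C M R"
    and cw: "c \<cdot>\<^bsub>C\<^esub> w = (d \<cdot>\<^bsub>C\<^esub> \<rho>) \<cdot>\<^bsub>C\<^esub> m" and dw: "d \<cdot>\<^bsub>C\<^esub> w = (c \<cdot>\<^bsub>C\<^esub> \<rho>) \<cdot>\<^bsub>C\<^esub> m"
    and M: "\<And>T u v. \<lbrakk>u \<in> hom C T E; v \<in> hom C T R;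
       c \<cdot>\<^bsub>C\<^esub> v = (d \<cdot>\<^bsub>C\<^esub> \<rho>) \<cdot>\<^bsub>C\<^esub> u; d \<cdot>\<^bsub>C\<^esub> v = (c \<cdot>\<^bsub>C\<^esub> \<rho>) \<cdot>\<^bsub>C\<^esub> u\<rbrakk> \<Longrightarrow> factors_through C u m"
    by (rule inverse_image_of_relation[OF C lim c d binary_relation_opposite[OF rel]
        hom_comp[OF C \<rho> d] hom_comp[OF C \<rho> c]]) (rule that)

  \<comment> \<open>The pair \<open>e r\<close> is diagonal, hence its own reverse.\<close>
  have s_in_M: "factors_through C s m"
    using M[OF s e] comp_assoc[OF C s \<rho> d] comp_assoc[OF C s \<rho> c] \<rho>s de ce by simp

  obtain D a b where pbD: "is_pullback C q \<pi> a b" and a: "a \<in> hom C D Z" and b: "b \<in> hom C D E"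
    by (rule pullback_exists[OF C lim q \<pi>]) (rule that)
  have sqD: "q \<cdot>\<^bsub>C\<^esub> a = \<pi> \<cdot>\<^bsub>C\<^esub> b" using pbD unfolding is_pullback_def by blast
  \<comment> \<open>Over \<open>Z\<close> both components of a kernel pair element start in the image of \<open>f\<close>, so the second
    one lifts to \<open>Z\<close>, where \<open>g\<close> reverses it.\<close>
  have \<rho>b: "\<rho> \<cdot>\<^bsub>C\<^esub> b \<in> hom C D R" and pa: "p \<cdot>\<^bsub>C\<^esub> a \<in> hom C D Y"
    using hom_comp[OF C b \<rho>] hom_comp[OF C a p] .
  have "f \<cdot>\<^bsub>C\<^esub> (p \<cdot>\<^bsub>C\<^esub> a) = d \<cdot>\<^bsub>C\<^esub> (q \<cdot>\<^bsub>C\<^esub> a)"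
    using comp_assoc[OF C a p f] comp_assoc[OF C a q d] fp by simp
  also have "\<dots> = d \<cdot>\<^bsub>C\<^esub> (\<rho> \<cdot>\<^bsub>C\<^esub> b)"
    using sqD sqE comp_assoc[OF C b \<pi> d] comp_assoc[OF C b \<rho> d] by simp
  finally have fpa: "f \<cdot>\<^bsub>C\<^esub> (p \<cdot>\<^bsub>C\<^esub> a) = d \<cdot>\<^bsub>C\<^esub> (\<rho> \<cdot>\<^bsub>C\<^esub> b)" .
  obtain z where z: "z \<in> hom C D Z" and pz: "p \<cdot>\<^bsub>C\<^esub> z = p \<cdot>\<^bsub>C\<^esub> a" and qz: "q \<cdot>\<^bsub>C\<^esub> z = \<rho> \<cdot>\<^bsub>C\<^esub> b"
    by (rule pullback_lift[OF pbZ f d p pa \<rho>b fpa]) (rule that)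
  have "c \<cdot>\<^bsub>C\<^esub> (g \<cdot>\<^bsub>C\<^esub> z) = (d \<cdot>\<^bsub>C\<^esub> \<rho>) \<cdot>\<^bsub>C\<^esub> b"
    using comp_assoc[OF C z g c] comp_assoc[OF C z p f] comp_assoc[OF C b \<rho> d] cg pz fpa by simp
  moreover have "d \<cdot>\<^bsub>C\<^esub> (g \<cdot>\<^bsub>C\<^esub> z) = (c \<cdot>\<^bsub>C\<^esub> \<rho>) \<cdot>\<^bsub>C\<^esub> b"
    using comp_assoc[OF C z g d] comp_assoc[OF C z q c] comp_assoc[OF C b \<rho> c] dg qz by simp
  ultimately have b_in_M: "factors_through C b m"
    using M[OF b hom_comp[OF C z g]] by blast

  have "jointly_strongly_epic C b s"
    using pm hom_Obj[OF C q] R E \<pi> s \<pi>s q pbD unfolding protomodular_def by blast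
  then have "is_invertible C m"
    using mono hom_Dom_Cod(3)[OF m] hom_Dom_Cod(3)[OF b] s_in_M b_in_M
    unfolding jointly_strongly_epic_def by simp
  then obtain n where n: "n \<in> hom C E M" and mn: "m \<cdot>\<^bsub>C\<^esub> n = Id C E"
    using hom_Dom_Cod[OF m] unfolding is_invertible_def by auto

  \<comment> \<open>As \<open>(r, r)\<close> lies in the subobject, \<open>w\<close> takes it to the reverse of \<open>r\<close>.\<close>
  define k where "k = n \<cdot>\<^bsub>C\<^esub> \<delta>"
  have k: "k \<in> hom C R M" unfolding k_def using hom_comp[OF C \<delta> n] .
  have mk: "m \<cdot>\<^bsub>C\<^esub> k = \<delta>"
    unfolding k_def using comp_assoc[OF C \<delta> n m] mn comp_Id[OF C \<delta>] by simp
  have *: "l \<cdot>\<^bsub>C\<^esub> (w \<cdot>\<^bsub>C\<^esub> k) = l'"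
    if l: "l \<in> hom C R X" and l': "l' \<in> hom C R X" and lw: "l \<cdot>\<^bsub>C\<^esub> w = (l' \<cdot>\<^bsub>C\<^esub> \<rho>) \<cdot>\<^bsub>C\<^esub> m" for l l'
    using comp_assoc[OF C k w l] lw comp_assoc[OF C k m hom_comp[OF C \<rho> l']] mk
      comp_assoc[OF C \<delta> \<rho> l'] \<rho>\<delta> comp_Id[OF C l'] by simp
  show ?thesis
    unfolding symmetric_relation_def relation_le_def
    using hom_comp[OF C k w] *[OF c d cw] *[OF d c dw] hom_Dom_Cod[OF d] hom_Dom_Cod[OF c] by auto
qed

section \<open>Pseudoreflexivity\<close>

lemma symmetric_imp_pseudoreflexive:
  assumes C: "category C" and rel: "binary_relation C X d c"
    and lpr: "left_pseudoreflexive C d c" and sym: "symmetric_relation C d c"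
  shows "pseudoreflexive C d c"
proof -
  obtain R where d: "d \<in> hom C R X" and c: "c \<in> hom C R X"
    by (rule binary_relation_hom[OF rel]) (rule that)
  obtain e where e: "e \<in> hom C R R" and de: "d \<cdot>\<^bsub>C\<^esub> e = d" and ce: "c \<cdot>\<^bsub>C\<^esub> e = d"
    using lpr hom_Dom_Cod[OF d] unfolding left_pseudoreflexive_def by auto
  obtain h where h: "h \<in> hom C R R" and ch: "c \<cdot>\<^bsub>C\<^esub> h = d" and dh: "d \<cdot>\<^bsub>C\<^esub> h = c"
    using sym hom_Dom_Cod[OF d] hom_Dom_Cod[OF c]
    unfolding symmetric_relation_def relation_le_def by auto
  have "d \<cdot>\<^bsub>C\<^esub> (e \<cdot>\<^bsub>C\<^esub> h) = c" "c \<cdot>\<^bsub>C\<^esub> (e \<cdot>\<^bsub>C\<^esub> h) = c"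
    using comp_assoc[OF C h e d] comp_assoc[OF C h e c] de ce dh by simp_all
  then show ?thesis
    using lpr hom_comp[OF C h e] hom_Dom_Cod[OF c]
    unfolding pseudoreflexive_def right_pseudoreflexive_def left_pseudoreflexive_def by auto
qed

text \<open>
  The relation is \<open>{(x, y). x \<in> M \<and> p x = p y}\<close>, the pullback of \<open>p m\<close> and \<open>p\<close>. Its first
  component lies in \<open>M\<close>, so right pseudoreflexivity, applied to the pairs \<open>(s (p y), y)\<close>, yields
  a section of \<open>m\<close>.
\<close>

lemma pseudoreflexive_imp_invertible:
  assumes C: "category C" and lim: "has_finite_limits C"
    and psr: "\<And>d c. \<lbrakk>binary_relation C E d c; left_pseudoreflexive C d c;
      left_pseudosymmetric C d c\<rbrakk> \<Longrightarrow> pseudoreflexive C d c"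
    and p: "p \<in> hom C E B" and s: "s \<in> hom C B E" and ps: "p \<cdot>\<^bsub>C\<^esub> s = Id C B"
    and f: "f \<in> hom C A B" and pbD: "is_pullback C f p a g"
    and m: "m \<in> hom C M E" and mono: "is_mono C m"
    and gm: "factors_through C g m" and sm: "factors_through C s m"
  shows "is_invertible C m"
proof -
  have E: "E \<in> Obj C" and A: "A \<in> Obj C"
    using hom_Obj[OF C p] hom_Obj[OF C f] by blast+
  obtain D where a: "a \<in> hom C D A" and g: "g \<in> hom C D E" and fa: "f \<cdot>\<^bsub>C\<^esub> a = p \<cdot>\<^bsub>C\<^esub> g"
    by (rule pullback_square[OF pbD f p]) (rule that)
  obtain g' where g': "g' \<in> hom C D M" and mg': "g = m \<cdot>\<^bsub>C\<^esub> g'"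
    using gm hom_Dom_Cod[OF g] hom_Dom_Cod[OF m] unfolding factors_through_def by auto
  obtain s' where s': "s' \<in> hom C B M" and ms': "s = m \<cdot>\<^bsub>C\<^esub> s'"
    using sm hom_Dom_Cod[OF s] hom_Dom_Cod[OF m] unfolding factors_through_def by auto
  have pm: "p \<cdot>\<^bsub>C\<^esub> m \<in> hom C M B" using hom_comp[OF C m p] .
  have p_m: "(p \<cdot>\<^bsub>C\<^esub> m) \<cdot>\<^bsub>C\<^esub> u = p \<cdot>\<^bsub>C\<^esub> (m \<cdot>\<^bsub>C\<^esub> u)" if "u \<in> hom C T M" for T u
    using comp_assoc[OF C that m p] .
  obtain R x c where pbR: "is_pullback C (p \<cdot>\<^bsub>C\<^esub> m) p x c"
    and x: "x \<in> hom C R M" and c: "c \<in> hom C R E"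
    by (rule pullback_exists[OF C lim pm p]) (rule that)
  define d where "d = m \<cdot>\<^bsub>C\<^esub> x"
  have d: "d \<in> hom C R E" unfolding d_def using hom_comp[OF C x m] .
  have d_assoc: "d \<cdot>\<^bsub>C\<^esub> h = m \<cdot>\<^bsub>C\<^esub> (x \<cdot>\<^bsub>C\<^esub> h)" if "h \<in> hom C T R" for T h
    unfolding d_def using comp_assoc[OF C that x m] .
  have pd: "p \<cdot>\<^bsub>C\<^esub> d = p \<cdot>\<^bsub>C\<^esub> c"
    using pbR p_m[OF x] unfolding d_def is_pullback_def by simp
  have pair: "\<exists>h \<in> hom C T R. x \<cdot>\<^bsub>C\<^esub> h = u \<and> d \<cdot>\<^bsub>C\<^esub> h = m \<cdot>\<^bsub>C\<^esub> u \<and> c \<cdot>\<^bsub>C\<^esub> h = v"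
    if u: "u \<in> hom C T M" and v: "v \<in> hom C T E" and eq: "p \<cdot>\<^bsub>C\<^esub> (m \<cdot>\<^bsub>C\<^esub> u) = p \<cdot>\<^bsub>C\<^esub> v" for T u v
    using pullback_lift[OF pbR pm p x u v] eq p_m[OF u] d_assoc by metis

  have rel: "binary_relation C E d c"
  proof -
    have "u = v" if u: "u \<in> hom C T R" and v: "v \<in> hom C T R"
      and eq: "d \<cdot>\<^bsub>C\<^esub> u = d \<cdot>\<^bsub>C\<^esub> v" "c \<cdot>\<^bsub>C\<^esub> u = c \<cdot>\<^bsub>C\<^esub> v" for T u v
    proof -
      have "x \<cdot>\<^bsub>C\<^esub> u = x \<cdot>\<^bsub>C\<^esub> v"
        using mono eq(1) d_assoc[OF u] d_assoc[OF v] hom_comp[OF C u x] hom_comp[OF C v x]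
          hom_Dom_Cod[OF m] unfolding is_mono_def by metis
      then show ?thesis using pullback_joint_mono[OF C pbR pm p x c u v] eq(2) by blast
    qed
    then show ?thesis
      using d c hom_Obj[OF C d] unfolding binary_relation_def by blast
  qed
  have lpr: "left_pseudoreflexive C d c"
    using pair[OF x d] hom_Dom_Cod[OF d] unfolding left_pseudoreflexive_def d_def by auto

  \<comment> \<open>If \<open>s f\<close> is the first component of a related pair, the second lies in a fibre over the image
    of \<open>f\<close>, hence in \<open>M\<close>; so the pair may be reversed.\<close>
  define t where "t = s \<cdot>\<^bsub>C\<^esub> f"
  have t: "t \<in> hom C A E" unfolding t_def using hom_comp[OF C f s] .
  have pt: "p \<cdot>\<^bsub>C\<^esub> t = f"
    unfolding t_def using comp_assoc[OF C f s p] ps comp_Id[OF C f] by simp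
  obtain Z y r where pbZ: "is_pullback C t d y r" and y: "y \<in> hom C Z A" and r: "r \<in> hom C Z R"
    by (rule pullback_exists[OF C lim t d]) (rule that)
  have ty: "t \<cdot>\<^bsub>C\<^esub> y = d \<cdot>\<^bsub>C\<^esub> r" using pbZ unfolding is_pullback_def by blast
  have cr: "c \<cdot>\<^bsub>C\<^esub> r \<in> hom C Z E" using hom_comp[OF C r c] .
  have "p \<cdot>\<^bsub>C\<^esub> (t \<cdot>\<^bsub>C\<^esub> y) = p \<cdot>\<^bsub>C\<^esub> (c \<cdot>\<^bsub>C\<^esub> r)"
    using ty pd comp_assoc[OF C r d p] comp_assoc[OF C r c p] by simp
  moreover have "p \<cdot>\<^bsub>C\<^esub> (t \<cdot>\<^bsub>C\<^esub> y) = f \<cdot>\<^bsub>C\<^esub> y"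
    using comp_assoc[OF C y t p] pt by simp
  ultimately have over_f: "f \<cdot>\<^bsub>C\<^esub> y = p \<cdot>\<^bsub>C\<^esub> (c \<cdot>\<^bsub>C\<^esub> r)"
    and over_t: "p \<cdot>\<^bsub>C\<^esub> (c \<cdot>\<^bsub>C\<^esub> r) = p \<cdot>\<^bsub>C\<^esub> (t \<cdot>\<^bsub>C\<^esub> y)" by simp_all
  obtain z where z: "z \<in> hom C Z D" and gz: "g \<cdot>\<^bsub>C\<^esub> z = c \<cdot>\<^bsub>C\<^esub> r"
    using pullback_lift[OF pbD f p a y cr over_f] by metis
  have g'z: "m \<cdot>\<^bsub>C\<^esub> (g' \<cdot>\<^bsub>C\<^esub> z) = c \<cdot>\<^bsub>C\<^esub> r"
    using comp_assoc[OF C z g' m] mg' gz by simp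
  have "\<exists>h \<in> hom C Z R. d \<cdot>\<^bsub>C\<^esub> h = c \<cdot>\<^bsub>C\<^esub> r \<and> c \<cdot>\<^bsub>C\<^esub> h = t \<cdot>\<^bsub>C\<^esub> y"
    using pair[OF hom_comp[OF C z g'] hom_comp[OF C y t]] g'z over_t by auto
  then have "exhibits_left_pseudosymmetric C t d c"
    using pbZ hom_Dom_Cod[OF y] hom_Dom_Cod[OF d] unfolding exhibits_left_pseudosymmetric_def by auto
  then have lps: "left_pseudosymmetric C d c"
    using A t hom_Dom_Cod[OF d] unfolding left_pseudosymmetric_def by auto

  obtain e where e: "e \<in> hom C R R" and de: "d \<cdot>\<^bsub>C\<^esub> e = c"
    using psr[OF rel lpr lps] hom_Dom_Cod[OF c]
    unfolding pseudoreflexive_def right_pseudoreflexive_def left_pseudoreflexive_def by auto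
  have "p \<cdot>\<^bsub>C\<^esub> (m \<cdot>\<^bsub>C\<^esub> (s' \<cdot>\<^bsub>C\<^esub> p)) = p \<cdot>\<^bsub>C\<^esub> Id C E"
    using comp_assoc[OF C p s' m] ms' comp_assoc[OF C p s p] ps comp_Id[OF C p] by simp
  then obtain k where k: "k \<in> hom C E R" and ck: "c \<cdot>\<^bsub>C\<^esub> k = Id C E"
    using pair[OF hom_comp[OF C p s'] hom_Id[OF C E]] by auto
  have ek: "e \<cdot>\<^bsub>C\<^esub> k \<in> hom C E R" using hom_comp[OF C k e] .
  have "m \<cdot>\<^bsub>C\<^esub> (x \<cdot>\<^bsub>C\<^esub> (e \<cdot>\<^bsub>C\<^esub> k)) = Id C E"
    using d_assoc[OF ek] comp_assoc[OF C k e d] de ck by simp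
  then show ?thesis
    using mono_with_section_invertible[OF C mono m hom_comp[OF C ek x]] by blast
qed

lemma pseudoreflexive_imp_protomodular:
  assumes C: "category C" and lim: "has_finite_limits C"
    and psr: "\<And>X d c. \<lbrakk>X \<in> Obj C; binary_relation C X d c; left_pseudoreflexive C d c;
      left_pseudosymmetric C d c\<rbrakk> \<Longrightarrow> pseudoreflexive C d c"
  shows "protomodular C"
proof -
  have "has_pullbacks C"
    unfolding has_pullbacks_def using pullback_exists[OF C lim]
    by (metis (mono_tags, lifting) hom_def mem_Collect_eq)
  moreover have "jointly_strongly_epic C g s"
    if E: "E \<in> Obj C" and p: "p \<in> hom C E B" and s: "s \<in> hom C B E" and f: "f \<in> hom C A B"
      and ps: "p \<cdot>\<^bsub>C\<^esub> s = Id C B" and pb: "is_pullback C f p a g" for A B E p s f a g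
  proof -
    obtain D where g: "g \<in> hom C D E" by (rule pullback_square[OF pb f p]) (rule that)
    have "is_invertible C m"
      if m: "is_mono C m" "Cod C m = E" "factors_through C g m" "factors_through C s m" for m
    proof -
      have "m \<in> hom C (Dom C m) E" using m(1,2) unfolding is_mono_def hom_def by simp
      then show ?thesis
        using pseudoreflexive_imp_invertible[OF C lim psr[OF E] p s ps f pb _ m(1,3,4)] by blast
    qed
    then show ?thesis
      using hom_Dom_Cod[OF g] hom_Dom_Cod[OF s] unfolding jointly_strongly_epic_def by simp
  qed
  ultimately show ?thesis unfolding protomodular_def by blast
qed

theorem theorem4p8:
  fixes C :: "('o, 'm) category_data"
  assumes "category C"
    and "has_finite_limits C"
  shows "(protomodular C \<longleftrightarrow>
           (\<forall>X\<in>Obj C. \<forall>d c. binary_relation C X d c \<and>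
             left_pseudoreflexive C d c \<and> left_pseudosymmetric C d c \<longrightarrow>
             symmetric_relation C d c)) \<and>
         ((\<forall>X\<in>Obj C. \<forall>d c. binary_relation C X d c \<and>
             left_pseudoreflexive C d c \<and> left_pseudosymmetric C d c \<longrightarrow>
             symmetric_relation C d c) \<longleftrightarrow>
           (\<forall>X\<in>Obj C. \<forall>d c. binary_relation C X d c \<and>
             left_pseudoreflexive C d c \<and> left_pseudosymmetric C d c \<longrightarrow>
             pseudoreflexive C d c))"
    (is "(?a \<longleftrightarrow> ?b) \<and> (?b \<longleftrightarrow> ?c)")
proof -
  have "?a \<Longrightarrow> ?b" using protomodular_imp_symmetric[OF assms] by blast
  moreover have "?b \<Longrightarrow> ?c" using symmetric_imp_pseudoreflexive[OF assms(1)] by meson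
  moreover have "?c \<Longrightarrow> ?a" using pseudoreflexive_imp_protomodular[OF assms] by meson
  ultimately show ?thesis by argo
qed

end
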